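(* Let $\mathcal{H}_n$ be a real Hilbert space of dimension $n$ and let $K\in\mathcal{B}(\mathcal{H}_n)$ be a positive semi-definite operator. Define $$\beta:=\begin{cases}\dfrac{\operatorname{tr}(K)}{N}+\sqrt{\dfrac{N\operatorname{tr}(K^2)-(\operatorname{tr}(K))^2}{N^2(N-1)}}, & \text{if } \operatorname{tr}(K^2)\ge\dfrac{(\operatorname{tr}(K))^2}{N},\\[2ex] \sqrt{\dfrac{(N-2)(\operatorname{tr}(K))^2+N\operatorname{tr}(K^2)}{N^2(N-1)}}, & \text{if } \operatorname{tr}(K^2)<\dfrac{(\operatorname{tr}(K))^2}{N}.\end{cases}$$ Then $\tilde r_2\ge\beta$. Moreover, if there exists a $2$-uniform $(N,n)$ $K$-dual pair, then $\tilde r_2=\beta$, and in this case an $(N,n)$ $K$-dual pair $(F,G)$ belongs to $\mathcal{R}_2$ if and only if it is a $2$-uniform $K$-dual pair.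
   Context: $\mathcal{B}(\mathcal{H}_n)$ is the algebra of bounded linear operators on $\mathcal{H}_n$, and $N$ is a fixed integer with $N\ge n$ and $N\ge 2$. For $K\in\mathcal{B}(\mathcal{H}_n)$, a sequence $F=\{f_i\}_{i=1}^N\subset\mathcal{H}_n$ is a $K$-frame if there are constants $0<A\le B<\infty$ with $A\|K^*f\|^2\le\sum_{i=1}^N|\langle f,f_i\rangle|^2\le B\|f\|^2$ for all $f\in\mathcal{H}_n$. A sequence $G=\{g_i\}_{i=1}^N\subset\mathcal{H}_n$ is a $K$-dual of the $K$-frame $F$ if $Kf=\sum_{i=1}^N\langle f,g_i\rangle f_i$ for all $f\in\mathcal{H}_n$ (equivalently $K^*f=\sum_{i=1}^N\langle f,f_i\rangle g_i$ for all $f$). In this case $(F,G)$ is called an $(N,n)$ $K$-dual pair for $\mathcal{H}_n$. For a $K$-dual pair $(F,G)$ and $m\in\{1,2\}$, $r_m(F,G)$ is the maximum, over all subsets $\Lambda\subset\{1,\dots,N\}$ with exactly $m$ elements, of the spectral radius (maximum modulus of complex eigenvalues) of the error operator $f\mapsto\sum_{i\in\Lambda}\langle f,f_i\rangle g_i$. Set $\tilde r_1:=\inf\{r_1(F,G):(F,G)\text{ is an }(N,n)\ K\text{-dual pair}\}$, $\mathcal{R}_1:=\{(F,G):r_1(F,G)=\tilde r_1\}$, $\tilde r_2:=\inf\{r_2(F,G):(F,G)\in\mathcal{R}_1\}$, and $\mathcal{R}_2:=\{(F,G)\in\mathcal{R}_1:r_2(F,G)=\tilde r_2\}$. A $K$-dual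 pair $(F,G)$ is $1$-uniform if there is a constant $c$ with $\langle f_i,g_i\rangle=c$ for all $i$. A $1$-uniform $K$-dual pair is $2$-uniform if there is a constant $c'$ with $\langle f_i,g_j\rangle\langle f_j,g_i\rangle=c'$ for all $i\ne j$. *)

theory Defs
  imports "HOL-Analysis.Analysis"
begin

(* The real Hilbert space of dimension n is a type 'a :: euclidean_space with DIM('a) = n.
   A sequence {f_i}, i = 1..N, is a function f :: nat => 'a of which only the values on {1..N}
   are ever used. *)

text \<open>For a basis that is orthonormal, as \<open>Basis\<close> is, the trace is the sum of the diagonal
  entries.\<close>

definition op_trace :: "('a::euclidean_space \<Rightarrow> 'a) \<Rightarrow> real" where
  "op_trace T = (\<Sum>b\<in>Basis. T b \<bullet> b)"

definition pos_semidef_op :: "('a::euclidean_space \<Rightarrow> 'a) \<Rightarrow> bool" where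
  "pos_semidef_op T \<longleftrightarrow> adjoint T = T \<and> (\<forall>x. 0 \<le> T x \<bullet> x)"

text \<open>A complex eigenvalue \<open>z\<close> of a real operator \<open>T\<close> is an eigenvalue of its complexification:
  \<open>T (u + \<i> v) = z (u + \<i> v)\<close> for some \<open>u + \<i> v \<noteq> 0\<close>, separated into real and imaginary parts.\<close>

definition complex_eigenvalue :: "('a::euclidean_space \<Rightarrow> 'a) \<Rightarrow> complex \<Rightarrow> bool" where
  "complex_eigenvalue T z \<longleftrightarrow>
     (\<exists>u v. (u \<noteq> 0 \<or> v \<noteq> 0) \<and>
            T u = Re z *\<^sub>R u - Im z *\<^sub>R v \<and>
            T v = Im z *\<^sub>R u + Re z *\<^sub>R v)"

text \<open>A linear operator on a nonzero finite-dimensional space has at least one and only finitely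
  many complex eigenvalues, so the maximum is meaningful.\<close>

definition op_spectral_radius :: "('a::euclidean_space \<Rightarrow> 'a) \<Rightarrow> real" where
  "op_spectral_radius T = Max (cmod ` {z. complex_eigenvalue T z})"

definition K_frame :: "('a::euclidean_space \<Rightarrow> 'a) \<Rightarrow> nat \<Rightarrow> (nat \<Rightarrow> 'a) \<Rightarrow> bool" where
  "K_frame K N F \<longleftrightarrow>
     (\<exists>A B. 0 < A \<and> A \<le> B \<and>
        (\<forall>f. A * (norm (adjoint K f))\<^sup>2 \<le> (\<Sum>i=1..N. \<bar>f \<bullet> F i\<bar>\<^sup>2) \<and>
             (\<Sum>i=1..N. \<bar>f \<bullet> F i\<bar>\<^sup>2) \<le> B * (norm f)\<^sup>2))"

definition K_dual_pair ::
  "('a::euclidean_space \<Rightarrow> 'a) \<Rightarrow> nat \<Rightarrow> (nat \<Rightarrow> 'a) \<Rightarrow> (nat \<Rightarrow> 'a) \<Rightarrow> bool" where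
  "K_dual_pair K N F G \<longleftrightarrow>
     K_frame K N F \<and> (\<forall>f. K f = (\<Sum>i=1..N. (f \<bullet> G i) *\<^sub>R F i))"

definition error_op ::
  "(nat \<Rightarrow> 'a::euclidean_space) \<Rightarrow> (nat \<Rightarrow> 'a) \<Rightarrow> nat set \<Rightarrow> 'a \<Rightarrow> 'a" where
  "error_op F G \<Lambda> f = (\<Sum>i\<in>\<Lambda>. (f \<bullet> F i) *\<^sub>R G i)"

definition err_r :: "nat \<Rightarrow> nat \<Rightarrow> (nat \<Rightarrow> 'a::euclidean_space) \<Rightarrow> (nat \<Rightarrow> 'a) \<Rightarrow> real" where
  "err_r N m F G =
     Max ((\<lambda>\<Lambda>. op_spectral_radius (error_op F G \<Lambda>)) ` {\<Lambda>. \<Lambda> \<subseteq> {1..N} \<and> card \<Lambda> = m})"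

definition opt_r1 :: "('a::euclidean_space \<Rightarrow> 'a) \<Rightarrow> nat \<Rightarrow> real" where
  "opt_r1 K N = Inf {err_r N 1 F G | F G. K_dual_pair K N F G}"

definition opt_pairs1 ::
  "('a::euclidean_space \<Rightarrow> 'a) \<Rightarrow> nat \<Rightarrow> ((nat \<Rightarrow> 'a) \<times> (nat \<Rightarrow> 'a)) set" where
  "opt_pairs1 K N = {(F, G). K_dual_pair K N F G \<and> err_r N 1 F G = opt_r1 K N}"

definition opt_r2 :: "('a::euclidean_space \<Rightarrow> 'a) \<Rightarrow> nat \<Rightarrow> real" where
  "opt_r2 K N = Inf {err_r N 2 F G | F G. (F, G) \<in> opt_pairs1 K N}"

definition opt_pairs2 ::
  "('a::euclidean_space \<Rightarrow> 'a) \<Rightarrow> nat \<Rightarrow> ((nat \<Rightarrow> 'a) \<times> (nat \<Rightarrow> 'a)) set" where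
  "opt_pairs2 K N = {(F, G). (F, G) \<in> opt_pairs1 K N \<and> err_r N 2 F G = opt_r2 K N}"

definition one_uniform_pair ::
  "('a::euclidean_space \<Rightarrow> 'a) \<Rightarrow> nat \<Rightarrow> (nat \<Rightarrow> 'a) \<Rightarrow> (nat \<Rightarrow> 'a) \<Rightarrow> bool" where
  "one_uniform_pair K N F G \<longleftrightarrow>
     K_dual_pair K N F G \<and> (\<exists>c. \<forall>i\<in>{1..N}. F i \<bullet> G i = c)"

definition two_uniform_pair ::
  "('a::euclidean_space \<Rightarrow> 'a) \<Rightarrow> nat \<Rightarrow> (nat \<Rightarrow> 'a) \<Rightarrow> (nat \<Rightarrow> 'a) \<Rightarrow> bool" where
  "two_uniform_pair K N F G \<longleftrightarrow>
     one_uniform_pair K N F G \<and>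
     (\<exists>c'. \<forall>i\<in>{1..N}. \<forall>j\<in>{1..N}. i \<noteq> j \<longrightarrow> (F i \<bullet> G j) * (F j \<bullet> G i) = c')"

definition beta :: "('a::euclidean_space \<Rightarrow> 'a) \<Rightarrow> nat \<Rightarrow> real" where
  "beta K N =
     (if op_trace (K \<circ> K) \<ge> (op_trace K)\<^sup>2 / real N
      then op_trace K / real N +
           sqrt ((real N * op_trace (K \<circ> K) - (op_trace K)\<^sup>2) / ((real N)\<^sup>2 * (real N - 1)))
      else sqrt (((real N - 2) * (op_trace K)\<^sup>2 + real N * op_trace (K \<circ> K)) /
                 ((real N)\<^sup>2 * (real N - 1))))"

end

theory Submission
  imports Defs
begin

text \<open>
  Write \<open>t\<close> for the trace of \<open>K\<close> and call the matrix of all \<open>F i \<bullet> G j\<close> the cross Gram matrix of a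
  dual pair. Its trace is \<open>t\<close> and the trace of its square is the trace of \<open>K \<circ> K\<close>
  (\<open>dual_pair_trace\<close>, \<open>dual_pair_trace_square\<close>), so the average of its diagonal entries does not
  depend on the pair, and once the diagonal is constant, neither does the average of the products
  \<open>p i j = (F i \<bullet> G j) * (F j \<bullet> G i)\<close> over \<open>i \<noteq> j\<close>. The nonzero spectrum of an error
  operator is that of the corresponding principal submatrix of the cross Gram matrix.

  For one erasure the spectral radius is \<open>\<bar>F i \<bullet> G i\<bar>\<close>, so the worst case is at least the average
  \<open>t / N \<ge> 0\<close>, with equality only if all diagonal entries coincide. Such pairs exist:
  rotating two members of both sequences by the same angle does not change the operator that the
  pair represents, and by the intermediate value theorem the angle can be chosen to make one more
  diagonal entry equal to the average (\<open>exists_constant_diagonal\<close>). A pair to start from needs \<open>n\<close>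
  vectors, where \<open>n \<le> N\<close> is the dimension. Hence the pairs that are optimal for one erasure are
  exactly the \<open>1\<close>-uniform ones.

  For two erasures \<open>{i, j}\<close> of such a pair the submatrix has diagonal \<open>t / N\<close> and off-diagonal
  product \<open>p i j\<close>, so its eigenvalues differ from \<open>t / N\<close> by the two square roots of \<open>p i j\<close>, and for
  \<open>p i j \<ge> 0\<close> the spectral radius is \<open>t / N + sqrt (p i j)\<close>. The average of the \<open>p i j\<close> is a
  nonnegative number \<open>q\<close>, because the Cauchy--Schwarz inequality gives
  \<open>t\<^sup>2 \<le> n * tr (K \<circ> K) \<le> N * tr (K \<circ> K)\<close>; in particular only the first case in the definition of
  \<open>beta\<close> occurs, and \<open>beta = t / N + sqrt q\<close>. Some \<open>p i j\<close> is at least \<open>q\<close>, which gives the lower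
  bound, and the bound is attained only if no \<open>p i j\<close> exceeds the average \<open>q\<close>, that is, if all of
  them are equal to it.
\<close>

section \<open>Spectral radii of error operators\<close>

lemma op_spectral_radius_eqI:
  assumes "complex_eigenvalue T w" and "cmod w = r" and "finite S"
    and "\<And>z. complex_eigenvalue T z \<Longrightarrow> z \<in> S \<and> cmod z \<le> r"
  shows "op_spectral_radius T = r"
proof -
  have "finite {z. complex_eigenvalue T z}"
    using assms(4) by (intro finite_subset[OF _ assms(3)]) auto
  then show ?thesis
    unfolding op_spectral_radius_def using assms by (intro Max_eqI) auto
qed

lemma complex_eigenvalue_of_real:
  assumes "w \<noteq> 0" and "T w = r *\<^sub>R w" and "T 0 = 0"
  shows "complex_eigenvalue T (complex_of_real r)"
  unfolding complex_eigenvalue_def using assms by (intro exI[of _ w] exI[of _ 0]) auto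

lemma error_op_zero [simp]: "error_op F G \<Lambda> 0 = 0"
  by (simp add: error_op_def)

text \<open>If \<open>T = A B\<close>, then \<open>B\<close> maps an eigenvector of \<open>T\<close> for \<open>z \<noteq> 0\<close> to an eigenvector of \<open>B A\<close>.
  Here \<open>B\<close> is the analysis map of \<open>F\<close> and \<open>A\<close> the synthesis map of \<open>G\<close>, restricted to \<open>\<Lambda>\<close>.\<close>

lemma error_op_eigenvalue_cross_gram:
  fixes F G :: "nat \<Rightarrow> 'a::euclidean_space"
  assumes "complex_eigenvalue (error_op F G \<Lambda>) z" and "z \<noteq> 0"
  obtains \<alpha> :: "nat \<Rightarrow> complex"
  where "\<exists>i\<in>\<Lambda>. \<alpha> i \<noteq> 0"
    and "\<And>j. j \<in> \<Lambda> \<Longrightarrow> z * \<alpha> j = (\<Sum>i\<in>\<Lambda>. \<alpha> i * complex_of_real (F j \<bullet> G i))"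
proof -
  let ?T = "error_op F G \<Lambda>"
  obtain u v where uv: "u \<noteq> 0 \<or> v \<noteq> 0"
    and u: "?T u = Re z *\<^sub>R u - Im z *\<^sub>R v" and v: "?T v = Im z *\<^sub>R u + Re z *\<^sub>R v"
    using assms(1) unfolding complex_eigenvalue_def by blast
  define \<alpha> where "\<alpha> i = Complex (u \<bullet> F i) (v \<bullet> F i)" for i
  have "z * \<alpha> j = (\<Sum>i\<in>\<Lambda>. \<alpha> i * complex_of_real (F j \<bullet> G i))" for j
  proof (rule complex_eqI)
    have "Re (z * \<alpha> j) = ?T u \<bullet> F j"
      by (simp add: u \<alpha>_def inner_diff_left)
    then show "Re (z * \<alpha> j) = Re (\<Sum>i\<in>\<Lambda>. \<alpha> i * complex_of_real (F j \<bullet> G i))"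
      by (simp add: error_op_def inner_sum_left \<alpha>_def inner_commute[of "G _" "F _"])
    have "Im (z * \<alpha> j) = ?T v \<bullet> F j"
      by (simp add: v \<alpha>_def inner_add_left)
    then show "Im (z * \<alpha> j) = Im (\<Sum>i\<in>\<Lambda>. \<alpha> i * complex_of_real (F j \<bullet> G i))"
      by (simp add: error_op_def inner_sum_left \<alpha>_def inner_commute[of "G _" "F _"])
  qed
  moreover have "\<exists>i\<in>\<Lambda>. \<alpha> i \<noteq> 0"
  proof (rule ccontr)
    assume "\<not> (\<exists>i\<in>\<Lambda>. \<alpha> i \<noteq> 0)"
    then have "u \<bullet> F i = 0 \<and> v \<bullet> F i = 0" if "i \<in> \<Lambda>" for i
      using that by (auto simp: \<alpha>_def Complex_eq_0)
    then have "?T u = 0" "?T v = 0"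
      by (simp_all add: error_op_def)
    \<comment> \<open>Multiplication by the conjugate of \<open>z\<close> undoes the multiplication by \<open>z\<close> up to \<open>cmod z\<^sup>2\<close>.\<close>
    then have "(Re z * Re z + Im z * Im z) *\<^sub>R u
        = Re z *\<^sub>R (Re z *\<^sub>R u - Im z *\<^sub>R v) + Im z *\<^sub>R (Im z *\<^sub>R u + Re z *\<^sub>R v)"
      "(Re z * Re z + Im z * Im z) *\<^sub>R v
        = Re z *\<^sub>R (Im z *\<^sub>R u + Re z *\<^sub>R v) - Im z *\<^sub>R (Re z *\<^sub>R u - Im z *\<^sub>R v)"
      by (simp_all add: algebra_simps)
    moreover have "Re z * Re z + Im z * Im z \<noteq> 0"
      using assms(2) by (simp add: complex_eq_iff sum_squares_eq_zero_iff)
    ultimately have "u = 0" "v = 0"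
      using u v \<open>?T u = 0\<close> \<open>?T v = 0\<close> by auto
    with uv show False by simp
  qed
  ultimately show thesis by (blast intro: that)
qed

lemma op_spectral_radius_error_op_single:
  fixes F G :: "nat \<Rightarrow> 'a::euclidean_space"
  shows "op_spectral_radius (error_op F G {i}) = \<bar>F i \<bullet> G i\<bar>"
proof (rule op_spectral_radius_eqI)
  let ?T = "error_op F G {i}"
  obtain e :: 'a where e: "e \<noteq> 0" using nonempty_Basis nonzero_Basis by blast
  have T: "?T f = (f \<bullet> F i) *\<^sub>R G i" for f by (simp add: error_op_def)
  show "complex_eigenvalue ?T (complex_of_real (F i \<bullet> G i))"
  proof (cases "G i = 0")
    case True
    then show ?thesis
      using e by (intro complex_eigenvalue_of_real[of e]) (auto simp: T)
  next
    case False
    then show ?thesis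
      by (intro complex_eigenvalue_of_real[of "G i"]) (auto simp: T inner_commute)
  qed
  fix z assume ev: "complex_eigenvalue ?T z"
  have "z = 0 \<or> z = complex_of_real (F i \<bullet> G i)"
  proof (cases "z = 0")
    case False
    from error_op_eigenvalue_cross_gram[OF ev this] obtain \<alpha> :: "nat \<Rightarrow> complex"
      where "\<alpha> i \<noteq> 0" and "z * \<alpha> i = \<alpha> i * complex_of_real (F i \<bullet> G i)"
      by auto
    then show ?thesis by simp
  qed simp
  then show "z \<in> {0, complex_of_real (F i \<bullet> G i)} \<and> cmod z \<le> \<bar>F i \<bullet> G i\<bar>"
    by auto
qed auto

text \<open>A nonzero eigenvalue \<open>z\<close> satisfies the characteristic equation \<open>(z - c)\<^sup>2 = p\<close> of the \<open>2 \<times> 2\<close>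
  submatrix, so the work is to show that the larger root is an eigenvalue of the operator even when it
  is \<open>0\<close> or when the submatrix is not diagonalizable.\<close>

lemma op_spectral_radius_error_op_pair:
  fixes F G :: "nat \<Rightarrow> 'a::euclidean_space"
  assumes "i \<noteq> j" and di: "F i \<bullet> G i = c" and dj: "F j \<bullet> G j = c" and "0 \<le> c"
    and p: "(F i \<bullet> G j) * (F j \<bullet> G i) = p" and "0 \<le> p"
  shows "op_spectral_radius (error_op F G {i, j}) = c + sqrt p"
proof (rule op_spectral_radius_eqI)
  let ?T = "error_op F G {i, j}"
  obtain e :: 'a where e: "e \<noteq> 0" using nonempty_Basis nonzero_Basis by blast
  have T: "?T f = (f \<bullet> F i) *\<^sub>R G i + (f \<bullet> F j) *\<^sub>R G j" for f
    using assms(1) by (simp add: error_op_def)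
  note comm = inner_commute[of "G _" "F _"]
  \<comment> \<open>In the degenerate case \<open>p = 0\<close> the submatrix is triangular, and \<open>G l\<close> is an eigenvector for
    \<open>c\<close> unless it vanishes. If it does, then \<open>c = 0\<close>, and the operator has rank at most one and
    square zero.\<close>
  have triangular: "complex_eigenvalue ?T (complex_of_real c)"
    if T': "\<And>f. ?T f = (f \<bullet> F k) *\<^sub>R G k + (f \<bullet> F l) *\<^sub>R G l"
      and d: "F k \<bullet> G k = c" "F l \<bullet> G l = c" and "F k \<bullet> G l = 0" for k l
  proof -
    consider "G l \<noteq> 0" | "G l = 0" "G k \<noteq> 0" | "G l = 0" "G k = 0" by blast
    then show ?thesis
    proof cases
      case 1
      then show ?thesis
        using that by (intro complex_eigenvalue_of_real[of "G l"]) (auto simp: comm)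
    next
      case 2
      then show ?thesis
        using that by (intro complex_eigenvalue_of_real[of "G k"]) (auto simp: comm)
    next
      case 3
      then show ?thesis
        using that e by (intro complex_eigenvalue_of_real[of e]) auto
    qed
  qed
  show "complex_eigenvalue ?T (complex_of_real (c + sqrt p))"
  proof (cases "p = 0")
    case True
    then have "F i \<bullet> G j = 0 \<or> F j \<bullet> G i = 0" using p by simp
    then show ?thesis
    proof
      assume "F i \<bullet> G j = 0"
      then show ?thesis using triangular[of i j] T di dj True by simp
    next
      assume "F j \<bullet> G i = 0"
      then show ?thesis using triangular[of j i] T di dj True by (simp add: add.commute)
    qed
  next
    case False
    \<comment> \<open>The vector \<open>(F i \<bullet> G j, sqrt p)\<close> is an eigenvector of the submatrix.\<close>
    define w where "w = (F i \<bullet> G j) *\<^sub>R G i + sqrt p *\<^sub>R G j"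
    have sq: "sqrt p * sqrt p = p" using assms(6) by simp
    have wi: "w \<bullet> F i = (c + sqrt p) * (F i \<bullet> G j)"
      by (simp add: w_def inner_add_left comm di algebra_simps)
    have wj: "w \<bullet> F j = (c + sqrt p) * sqrt p"
      using p by (simp add: w_def inner_add_left comm dj distrib_right sq del: real_sqrt_mult_self)
    have "(c + sqrt p) * sqrt p > 0"
      using False assms(4,6) by (intro mult_pos_pos add_nonneg_pos) auto
    then have "w \<noteq> 0" using wj by auto
    moreover have "?T w = (c + sqrt p) *\<^sub>R w"
      by (simp add: T wi wj) (simp add: w_def scaleR_add_right)
    ultimately show ?thesis
      by (intro complex_eigenvalue_of_real) auto
  qed
  show "cmod (complex_of_real (c + sqrt p)) = c + sqrt p"
    using assms(4,6) by (simp only: norm_of_real) simp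
  let ?S = "{0, complex_of_real (c + sqrt p), complex_of_real (c - sqrt p)}"
  show "finite ?S" by simp
  fix z assume ev: "complex_eigenvalue ?T z"
  have "z \<in> ?S"
  proof (cases "z = 0")
    case False
    from error_op_eigenvalue_cross_gram[OF ev this] obtain \<alpha> :: "nat \<Rightarrow> complex"
      where nz: "\<exists>k\<in>{i, j}. \<alpha> k \<noteq> 0"
        and ev_eq: "\<And>k. k \<in> {i, j} \<Longrightarrow>
          z * \<alpha> k = (\<Sum>l\<in>{i, j}. \<alpha> l * complex_of_real (F k \<bullet> G l))"
      by blast
    have ei: "z * \<alpha> i = \<alpha> i * c + \<alpha> j * (F i \<bullet> G j)"
      and ej: "z * \<alpha> j = \<alpha> i * (F j \<bullet> G i) + \<alpha> j * c"
      using ev_eq[of i] ev_eq[of j] assms(1) by (auto simp: di dj)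
    have "(z - c) * (z - c) * \<alpha> i = complex_of_real ((F i \<bullet> G j) * (F j \<bullet> G i)) * \<alpha> i"
      "(z - c) * (z - c) * \<alpha> j = complex_of_real ((F i \<bullet> G j) * (F j \<bullet> G i)) * \<alpha> j"
      using ei ej unfolding of_real_mult by algebra+
    then have "(z - c) * (z - c) = complex_of_real p"
      using nz p by (auto simp: mult_right_cancel)
    also have "\<dots> = complex_of_real (sqrt p) * complex_of_real (sqrt p)"
      using assms(6) by (simp flip: of_real_mult)
    finally have "z - c = complex_of_real (sqrt p) \<or> z - c = - complex_of_real (sqrt p)"
      by (simp only: square_eq_iff)
    then show ?thesis by (auto simp: algebra_simps)
  qed simp
  moreover have "cmod x \<le> c + sqrt p" if "x \<in> ?S" for x
  proof -
    have "0 \<le> sqrt p" using assms(6) by simp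
    then have "\<bar>c - sqrt p\<bar> \<le> c + sqrt p" "\<bar>c + sqrt p\<bar> \<le> c + sqrt p"
      using assms(4) by linarith+
    then show ?thesis
      using that \<open>0 \<le> sqrt p\<close> assms(4) by (elim insertE) (simp_all only: norm_of_real, auto)
  qed
  ultimately show "z \<in> ?S \<and> cmod z \<le> c + sqrt p" by blast
qed

section \<open>Trace identities for dual pairs\<close>

lemma dual_pair_trace:
  fixes K :: "'a::euclidean_space \<Rightarrow> 'a"
  assumes "\<And>f. K f = (\<Sum>i\<in>I. (f \<bullet> G i) *\<^sub>R F i)"
  shows "op_trace K = (\<Sum>i\<in>I. F i \<bullet> G i)"
proof -
  have "op_trace K = (\<Sum>b\<in>Basis. \<Sum>i\<in>I. (F i \<bullet> b) * (G i \<bullet> b))"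
    by (simp add: op_trace_def assms inner_sum_left inner_commute[of _ "G _"] mult.commute)
  also have "\<dots> = (\<Sum>i\<in>I. F i \<bullet> G i)"
    by (subst sum.swap) (simp flip: euclidean_inner)
  finally show ?thesis .
qed

lemma dual_pair_trace_square:
  fixes K :: "'a::euclidean_space \<Rightarrow> 'a"
  assumes "\<And>f. K f = (\<Sum>i\<in>I. (f \<bullet> G i) *\<^sub>R F i)"
  shows "op_trace (K \<circ> K) = (\<Sum>i\<in>I. \<Sum>j\<in>I. (F i \<bullet> G j) * (F j \<bullet> G i))"
proof -
  \<comment> \<open>The operator \<open>K \<circ> K\<close> is represented by \<open>G\<close> together with the images of \<open>F\<close> under \<open>K\<close>.\<close>
  have "linear K"
    by (rule linearI)
      (simp_all add: assms inner_add_left scaleR_add_left sum.distrib scaleR_sum_right)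
  then have "(K \<circ> K) f = (\<Sum>i\<in>I. (f \<bullet> G i) *\<^sub>R K (F i))" for f
    by (simp add: assms[of f] linear_sum linear_scale o_def)
  then have "op_trace (K \<circ> K) = (\<Sum>i\<in>I. K (F i) \<bullet> G i)"
    by (rule dual_pair_trace)
  then show ?thesis
    by (simp add: assms inner_sum_left)
qed

text \<open>Apply the Cauchy--Schwarz inequality to the diagonal entries of \<open>K\<close>, and bound the square of
  each diagonal entry by the squared norm of its column; for self-adjoint \<open>K\<close> these norms add up to the
  trace of \<open>K \<circ> K\<close>.\<close>

lemma op_trace_square_le:
  fixes K :: "'a::euclidean_space \<Rightarrow> 'a"
  assumes "linear K" and "adjoint K = K"
  shows "(op_trace K)\<^sup>2 \<le> DIM('a) * op_trace (K \<circ> K)"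
proof -
  have "(op_trace K)\<^sup>2 \<le> (\<Sum>b\<in>Basis. (K b \<bullet> b)\<^sup>2) * DIM('a)"
    unfolding op_trace_def using Cauchy_Schwarz_ineq_sum[of "\<lambda>b. K b \<bullet> b" "\<lambda>_. 1" "Basis :: 'a set"]
    by simp
  also have "(\<Sum>b\<in>Basis. (K b \<bullet> b)\<^sup>2) \<le> op_trace (K \<circ> K)"
    unfolding op_trace_def
  proof (rule sum_mono)
    fix b :: 'a assume b: "b \<in> Basis"
    have "(K b \<bullet> b)\<^sup>2 \<le> (K b \<bullet> K b) * (b \<bullet> b)"
      by (rule Cauchy_Schwarz_ineq)
    also have "\<dots> = (K \<circ> K) b \<bullet> b"
      using b adjoint_works[OF assms(1), of "K b" b] assms(2) by (simp add: inner_commute)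
    finally show "(K b \<bullet> b)\<^sup>2 \<le> (K \<circ> K) b \<bullet> b" .
  qed
  finally show ?thesis by (simp add: mult.commute)
qed

section \<open>Dual pairs that are optimal for one erasure\<close>

lemma card_filter_eq_less:
  assumes "finite I" and "i \<in> I" and "\<not> P i" and "Q i" and "\<And>k. k \<in> I \<Longrightarrow> P k \<Longrightarrow> Q k"
  shows "card {k \<in> I. \<not> Q k} < card {k \<in> I. \<not> P k}"
  using assms by (intro psubset_card_mono) auto

lemma sum_remove_two:
  fixes f :: "nat \<Rightarrow> 'b::comm_monoid_add"
  assumes "finite I" and "i \<in> I" and "j \<in> I" and "i \<noteq> j"
  shows "sum f I = f i + f j + sum f (I - {i, j})"
  using assms sum.subset_diff[of "{i, j}" I f] by (simp add: add.commute)

text \<open>Rotating two members of both sequences by the same angle keeps the represented operator. The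
  quarter turn puts the second of the two diagonal entries in the place of the first, so by continuity
  smaller angles give this place every value between the two.\<close>

lemma exists_rotation:
  fixes F G :: "nat \<Rightarrow> 'a::euclidean_space"
  assumes "finite I" and ij: "i \<in> I" "j \<in> I" "i \<noteq> j"
    and m: "F i \<bullet> G i \<le> m" "m \<le> F j \<bullet> G j"
  obtains F' G' where "\<And>f. (\<Sum>k\<in>I. (f \<bullet> G' k) *\<^sub>R F' k) = (\<Sum>k\<in>I. (f \<bullet> G k) *\<^sub>R F k)"
    and "F' i \<bullet> G' i = m" and "\<And>k. k \<noteq> i \<Longrightarrow> k \<noteq> j \<Longrightarrow> F' k \<bullet> G' k = F k \<bullet> G k"
proof -
  define d where "d \<theta> = (cos \<theta> *\<^sub>R F i + sin \<theta> *\<^sub>R F j) \<bullet> (cos \<theta> *\<^sub>R G i + sin \<theta> *\<^sub>R G j)" for \<theta>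
  have "\<exists>\<theta>. 0 \<le> \<theta> \<and> \<theta> \<le> pi / 2 \<and> d \<theta> = m"
  proof (rule IVT')
    show "continuous_on {0..pi / 2} d"
      unfolding d_def by (intro continuous_intros)
  qed (use m in \<open>auto simp: d_def\<close>)
  then obtain \<theta> where \<theta>: "d \<theta> = m" by blast
  define rot where "rot H = H(i := cos \<theta> *\<^sub>R H i + sin \<theta> *\<^sub>R H j,
                              j := (- sin \<theta>) *\<^sub>R H i + cos \<theta> *\<^sub>R H j)" for H :: "nat \<Rightarrow> 'a"
  show thesis
  proof (rule that)
    show "(\<Sum>k\<in>I. (f \<bullet> rot G k) *\<^sub>R rot F k) = (\<Sum>k\<in>I. (f \<bullet> G k) *\<^sub>R F k)" for f
    proof -
      have cs: "cos \<theta> * cos \<theta> = 1 - sin \<theta> * sin \<theta>"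
        using sin_cos_squared_add3[of \<theta>] by (simp add: algebra_simps)
      let ?a = "f \<bullet> G i" and ?b = "f \<bullet> G j"
      have i: "(f \<bullet> rot G i) *\<^sub>R rot F i
          = (cos \<theta> * cos \<theta> * ?a + cos \<theta> * sin \<theta> * ?b) *\<^sub>R F i
            + (cos \<theta> * sin \<theta> * ?a + sin \<theta> * sin \<theta> * ?b) *\<^sub>R F j"
        using ij(3) by (simp add: rot_def inner_add_right algebra_simps)
      have j: "(f \<bullet> rot G j) *\<^sub>R rot F j
          = (sin \<theta> * sin \<theta> * ?a - cos \<theta> * sin \<theta> * ?b) *\<^sub>R F i
            + (cos \<theta> * cos \<theta> * ?b - cos \<theta> * sin \<theta> * ?a) *\<^sub>R F j"
        by (simp add: rot_def inner_add_right algebra_simps)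
      have "(f \<bullet> rot G i) *\<^sub>R rot F i + (f \<bullet> rot G j) *\<^sub>R rot F j = ?a *\<^sub>R F i + ?b *\<^sub>R F j"
        unfolding i j cs by (simp add: algebra_simps)
      moreover have "(\<Sum>k\<in>I - {i, j}. (f \<bullet> rot G k) *\<^sub>R rot F k)
          = (\<Sum>k\<in>I - {i, j}. (f \<bullet> G k) *\<^sub>R F k)"
        by (intro sum.cong) (auto simp: rot_def)
      ultimately show ?thesis
        by (simp only: sum_remove_two[OF assms(1) ij])
    qed
    show "rot F i \<bullet> rot G i = m"
      using \<theta> ij(3) by (simp add: rot_def d_def)
    show "rot F k \<bullet> rot G k = F k \<bullet> G k" if "k \<noteq> i" "k \<noteq> j" for k
      using that by (simp add: rot_def)
  qed
qed

text \<open>As long as the diagonal is not constant, some entry lies below the average and some entry above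
  it; a rotation of these two makes one of them average and leaves all other entries alone. The
  average itself is preserved, being the trace of the represented operator.\<close>

lemma exists_constant_diagonal:
  fixes F G :: "nat \<Rightarrow> 'a::euclidean_space" and m :: real
  assumes "finite I" and "(\<Sum>k\<in>I. F k \<bullet> G k) = card I * m"
  shows "\<exists>F' G'. (\<forall>f. (\<Sum>k\<in>I. (f \<bullet> G' k) *\<^sub>R F' k) = (\<Sum>k\<in>I. (f \<bullet> G k) *\<^sub>R F k)) \<and>
                 (\<forall>k\<in>I. F' k \<bullet> G' k = m)"
  using assms(2)
proof (induction "card {k \<in> I. F k \<bullet> G k \<noteq> m}" arbitrary: F G rule: less_induct)
  case less
  show ?case
  proof (cases "\<forall>k\<in>I. F k \<bullet> G k = m")
    case True
    then show ?thesis by blast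
  next
    case False
    have zero: "(\<Sum>k\<in>I. F k \<bullet> G k - m) = 0" "(\<Sum>k\<in>I. m - F k \<bullet> G k) = 0"
      using less.prems by (simp_all add: sum_subtractf)
    have "\<exists>i\<in>I. F i \<bullet> G i < m"
    proof (rule ccontr)
      assume "\<not> ?thesis"
      then have "\<forall>k\<in>I. F k \<bullet> G k - m = 0"
        using zero(1) assms(1) by (subst (asm) sum_nonneg_eq_0_iff) (auto simp: not_less)
      with False show False by simp
    qed
    moreover have "\<exists>j\<in>I. m < F j \<bullet> G j"
    proof (rule ccontr)
      assume "\<not> ?thesis"
      then have "\<forall>k\<in>I. m - F k \<bullet> G k = 0"
        using zero(2) assms(1) by (subst (asm) sum_nonneg_eq_0_iff) (auto simp: not_less)
      with False show False by simp
    qed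
    ultimately obtain i j where i: "i \<in> I" "F i \<bullet> G i < m" and j: "j \<in> I" "m < F j \<bullet> G j"
      by blast
    then have "i \<noteq> j" by auto
    obtain F' G' where FG': "\<And>f. (\<Sum>k\<in>I. (f \<bullet> G' k) *\<^sub>R F' k) = (\<Sum>k\<in>I. (f \<bullet> G k) *\<^sub>R F k)"
      and m: "F' i \<bullet> G' i = m"
      and others: "\<And>k. k \<noteq> i \<Longrightarrow> k \<noteq> j \<Longrightarrow> F' k \<bullet> G' k = F k \<bullet> G k"
      using exists_rotation[OF assms(1) i(1) j(1) \<open>i \<noteq> j\<close> less_imp_le[OF i(2)] less_imp_le[OF j(2)]]
      by blast
    have "F' k \<bullet> G' k = m" if "F k \<bullet> G k = m" for k
      using others[of k] that i(2) j(2) by fastforce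
    then have "card {k \<in> I. F' k \<bullet> G' k \<noteq> m} < card {k \<in> I. F k \<bullet> G k \<noteq> m}"
      using i m assms(1) by (intro card_filter_eq_less[of I i]) auto
    moreover have "(\<Sum>k\<in>I. F' k \<bullet> G' k) = (\<Sum>k\<in>I. F k \<bullet> G k)"
      using dual_pair_trace[of "\<lambda>f. \<Sum>k\<in>I. (f \<bullet> G k) *\<^sub>R F k" G F I]
        dual_pair_trace[of "\<lambda>f. \<Sum>k\<in>I. (f \<bullet> G k) *\<^sub>R F k" G' F' I] FG'
      by simp
    ultimately obtain F'' G''
      where "\<And>f. (\<Sum>k\<in>I. (f \<bullet> G'' k) *\<^sub>R F'' k) = (\<Sum>k\<in>I. (f \<bullet> G' k) *\<^sub>R F' k)"
        and "\<And>k. k \<in> I \<Longrightarrow> F'' k \<bullet> G'' k = m"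
      using less.hyps[of F' G'] less.prems by metis
    then show ?thesis
      using FG' by (intro exI[of _ F''] exI[of _ G'']) auto
  qed
qed

text \<open>The representation of \<open>K\<close> forces the lower frame bound: apply the Cauchy--Schwarz inequality to
  \<open>(norm (adjoint K f))\<^sup>2 = K (adjoint K f) \<bullet> f\<close>.\<close>

lemma K_dual_pairI:
  fixes K :: "'a::euclidean_space \<Rightarrow> 'a"
  assumes rep: "\<And>f. K f = (\<Sum>i=1..N. (f \<bullet> G i) *\<^sub>R F i)"
  shows "K_dual_pair K N F G"
proof -
  \<comment> \<open>The summand \<open>1\<close> makes both constants positive and \<open>1 / a \<le> b\<close>.\<close>
  define a where "a = 1 + (\<Sum>i=1..N. (norm (G i))\<^sup>2)"
  define b where "b = 1 + (\<Sum>i=1..N. (norm (F i))\<^sup>2)"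
  have a: "a \<ge> 1" and b: "b \<ge> 1"
    by (simp_all add: a_def b_def sum_nonneg)
  have "linear K"
    by (rule linearI)
      (simp_all add: rep inner_add_left scaleR_add_left sum.distrib scaleR_sum_right)
  have lower: "1 / a * (norm (adjoint K f))\<^sup>2 \<le> (\<Sum>i=1..N. \<bar>f \<bullet> F i\<bar>\<^sup>2)" for f
  proof -
    let ?s = "\<Sum>i=1..N. (f \<bullet> F i)\<^sup>2" and ?g = "adjoint K f"
    have "(norm ?g)\<^sup>2 = K ?g \<bullet> f"
      using adjoint_works[OF \<open>linear K\<close>, of ?g f] by (simp add: power2_norm_eq_inner)
    also have "\<dots> = (\<Sum>i=1..N. (?g \<bullet> G i) * (f \<bullet> F i))"
      by (simp add: rep[of ?g] inner_sum_left inner_commute[of "F _" f])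
    finally have "((norm ?g)\<^sup>2)\<^sup>2 \<le> (\<Sum>i=1..N. (?g \<bullet> G i)\<^sup>2) * ?s"
      using Cauchy_Schwarz_ineq_sum[of "\<lambda>i. ?g \<bullet> G i" "\<lambda>i. f \<bullet> F i" "{1..N}"] by simp
    also have "\<dots> \<le> (\<Sum>i=1..N. (norm ?g)\<^sup>2 * (norm (G i))\<^sup>2) * ?s"
      using Cauchy_Schwarz_ineq[of ?g]
      by (intro mult_right_mono sum_mono) (auto simp: power2_norm_eq_inner sum_nonneg)
    also have "\<dots> \<le> (norm ?g)\<^sup>2 * a * ?s"
      by (intro mult_right_mono) (auto simp: a_def distrib_left sum_distrib_left sum_nonneg)
    finally have le: "(norm ?g)\<^sup>2 * (norm ?g)\<^sup>2 \<le> (norm ?g)\<^sup>2 * (a * ?s)"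
      by (simp add: power2_eq_square mult.assoc)
    have "(norm ?g)\<^sup>2 \<le> a * ?s"
    proof (cases "norm ?g = 0")
      case True
      then show ?thesis using a by (simp add: sum_nonneg)
    next
      case False
      then have "0 < (norm ?g)\<^sup>2" by simp
      with le show ?thesis by (simp only: mult_le_cancel_left_pos)
    qed
    then show ?thesis
      using a by (simp add: field_simps)
  qed
  have upper: "(\<Sum>i=1..N. \<bar>f \<bullet> F i\<bar>\<^sup>2) \<le> b * (norm f)\<^sup>2" for f
  proof -
    have "(\<Sum>i=1..N. \<bar>f \<bullet> F i\<bar>\<^sup>2) \<le> (\<Sum>i=1..N. (norm f)\<^sup>2 * (norm (F i))\<^sup>2)"
      using Cauchy_Schwarz_ineq[of f] by (intro sum_mono) (simp add: power2_norm_eq_inner)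
    also have "\<dots> \<le> b * (norm f)\<^sup>2"
      by (simp add: b_def algebra_simps sum_distrib_left)
    finally show ?thesis .
  qed
  have "1 / a \<le> b" using a b order_trans[of "1 / a" 1 b] by simp
  then have "K_frame K N F"
    unfolding K_frame_def using lower upper a by (intro exI[of _ "1 / a"] exI[of _ b]) auto
  then show ?thesis
    using rep by (simp add: K_dual_pair_def)
qed

text \<open>Start from the images of an orthonormal basis under \<open>K\<close> together with the basis, padded with
  zeros, and make the diagonal constant.\<close>

lemma exists_one_uniform_pair:
  fixes K :: "'a::euclidean_space \<Rightarrow> 'a"
  assumes "linear K" and "DIM('a) \<le> N"
  shows "\<exists>F G. one_uniform_pair K N F G"
proof -
  let ?n = "DIM('a)"
  obtain h where h: "bij_betw h {1..?n} (Basis :: 'a set)"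
    using ex_bij_betw_nat_finite_1[OF finite_Basis] by blast
  define G where "G i = (if i \<le> ?n then h i else 0)" for i
  define F where "F i = K (G i)" for i
  have rep: "K f = (\<Sum>i=1..N. (f \<bullet> G i) *\<^sub>R F i)" for f
  proof -
    have "(\<Sum>i=1..N. (f \<bullet> G i) *\<^sub>R F i) = (\<Sum>i=1..?n. (f \<bullet> h i) *\<^sub>R K (h i))"
      using assms(2) by (intro sum.mono_neutral_cong_right) (auto simp: G_def F_def)
    also have "\<dots> = (\<Sum>b\<in>Basis. (f \<bullet> b) *\<^sub>R K b)"
      using sum.reindex_bij_betw[OF h, of "\<lambda>b. (f \<bullet> b) *\<^sub>R K b"] .
    also have "\<dots> = K (\<Sum>b\<in>Basis. (f \<bullet> b) *\<^sub>R b)"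
      using assms(1) by (simp add: linear_sum linear_scale)
    finally show ?thesis by (simp add: euclidean_representation)
  qed
  have "N \<noteq> 0" using assms(2) DIM_positive[where 'a = 'a] by linarith
  then have "(\<Sum>i=1..N. F i \<bullet> G i) = card {1..N} * (op_trace K / N)"
    using dual_pair_trace[OF rep] by simp
  from exists_constant_diagonal[OF finite_atLeastAtMost this] obtain F' G'
    where "\<forall>f. (\<Sum>i=1..N. (f \<bullet> G' i) *\<^sub>R F' i) = (\<Sum>i=1..N. (f \<bullet> G i) *\<^sub>R F i)"
      and const: "\<forall>i\<in>{1..N}. F' i \<bullet> G' i = op_trace K / N"
    by blast
  then have "K_dual_pair K N F' G'"
    by (intro K_dual_pairI) (simp add: rep)
  then show ?thesis
    using const unfolding one_uniform_pair_def by blast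
qed

lemma one_uniform_pair_iff:
  fixes K :: "'a::euclidean_space \<Rightarrow> 'a"
  assumes "0 < N"
  shows "one_uniform_pair K N F G \<longleftrightarrow>
    K_dual_pair K N F G \<and> (\<forall>i\<in>{1..N}. F i \<bullet> G i = op_trace K / N)"
proof -
  have "c = op_trace K / N" if "K_dual_pair K N F G" "\<forall>i\<in>{1..N}. F i \<bullet> G i = c" for c
    using that assms dual_pair_trace[of K G F "{1..N}"] by (auto simp: K_dual_pair_def)
  then show ?thesis
    unfolding one_uniform_pair_def by blast
qed

lemma err_r_1:
  fixes F G :: "nat \<Rightarrow> 'a::euclidean_space"
  shows "err_r N 1 F G = Max ((\<lambda>i. \<bar>F i \<bullet> G i\<bar>) ` {1..N})"
proof -
  have "{\<Lambda>. \<Lambda> \<subseteq> {1..N} \<and> card \<Lambda> = 1} = (\<lambda>i. {i}) ` {1..N}"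
    by (auto simp: card_1_singleton_iff)
  then show ?thesis
    by (simp add: err_r_def image_image op_spectral_radius_error_op_single)
qed

lemma sum_le_const_imp_eq:
  fixes f :: "'i \<Rightarrow> real" and m :: real
  assumes "finite A" and "\<And>x. x \<in> A \<Longrightarrow> f x \<le> m" and "sum f A = card A * m" and "x \<in> A"
  shows "f x = m"
proof -
  have "(\<Sum>x\<in>A. m - f x) = 0" using assms(3) by (simp add: sum_subtractf)
  then show ?thesis
    using assms by (subst (asm) sum_nonneg_eq_0_iff) auto
qed

lemma exists_ge_average:
  fixes f :: "'i \<Rightarrow> real" and m :: real
  assumes "finite A" and "A \<noteq> {}" and "sum f A = card A * m"
  shows "\<exists>x\<in>A. m \<le> f x"
  using sum_bounded_above_strict[of A f m] assms card_gt_0_iff[of A] by (force simp: not_le)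

lemma err_r_1_ge:
  assumes "K_dual_pair K N F G" and "0 < N"
  shows "op_trace K / N \<le> err_r N 1 F G"
proof -
  have sum: "(\<Sum>i=1..N. F i \<bullet> G i) = card {1..N} * (op_trace K / N)"
    using assms dual_pair_trace[of K G F "{1..N}"] by (simp add: K_dual_pair_def)
  obtain i where "i \<in> {1..N}" "op_trace K / N \<le> F i \<bullet> G i"
    using exists_ge_average[OF _ _ sum] assms(2) by auto
  moreover from this have "\<bar>F i \<bullet> G i\<bar> \<le> err_r N 1 F G"
    unfolding err_r_1 by (intro Max_ge) auto
  ultimately show ?thesis by linarith
qed

lemma err_r_1_eq_iff:
  assumes "K_dual_pair K N F G" and "0 < N" and "0 \<le> op_trace K"
  shows "err_r N 1 F G = op_trace K / N \<longleftrightarrow> one_uniform_pair K N F G"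
proof
  assume eq: "err_r N 1 F G = op_trace K / N"
  have sum: "(\<Sum>i=1..N. F i \<bullet> G i) = card {1..N} * (op_trace K / N)"
    using assms dual_pair_trace[of K G F "{1..N}"] by (simp add: K_dual_pair_def)
  have "F i \<bullet> G i \<le> op_trace K / N" if "i \<in> {1..N}" for i
  proof -
    have "\<bar>F i \<bullet> G i\<bar> \<le> err_r N 1 F G"
      unfolding err_r_1 using that by (intro Max_ge) auto
    then show ?thesis using eq by linarith
  qed
  then have "F i \<bullet> G i = op_trace K / N" if "i \<in> {1..N}" for i
    using sum_le_const_imp_eq[OF _ _ sum that] by blast
  then show "one_uniform_pair K N F G"
    using assms by (simp add: one_uniform_pair_iff)
next
  assume "one_uniform_pair K N F G"
  then have "\<And>i. i \<in> {1..N} \<Longrightarrow> \<bar>F i \<bullet> G i\<bar> = op_trace K / N"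
    using assms by (simp add: one_uniform_pair_iff)
  then have "(\<lambda>i. \<bar>F i \<bullet> G i\<bar>) ` {1..N} = (\<lambda>_. op_trace K / N) ` {1..N}"
    by (intro image_cong) auto
  then show "err_r N 1 F G = op_trace K / N"
    unfolding err_r_1 using assms(2) by (simp add: image_constant_conv)
qed

lemma opt_pairs1_iff_one_uniform:
  fixes K :: "'a::euclidean_space \<Rightarrow> 'a"
  assumes "linear K" and "DIM('a) \<le> N" and "0 \<le> op_trace K"
  shows "(F, G) \<in> opt_pairs1 K N \<longleftrightarrow> one_uniform_pair K N F G"
proof -
  have N: "0 < N" using assms(2) DIM_positive[where 'a = 'a] by linarith
  obtain F0 G0 where u: "one_uniform_pair K N F0 G0"
    using exists_one_uniform_pair assms by blast
  then have "K_dual_pair K N F0 G0" by (simp add: one_uniform_pair_def)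
  then have attained: "op_trace K / N = err_r N 1 F0 G0"
    using u err_r_1_eq_iff[OF _ N assms(3)] by metis
  have "opt_r1 K N = op_trace K / N"
    unfolding opt_r1_def
  proof (rule cInf_eq_minimum)
    show "op_trace K / N \<in> {err_r N 1 F G |F G. K_dual_pair K N F G}"
      using attained \<open>K_dual_pair K N F0 G0\<close> by blast
  qed (use err_r_1_ge[OF _ N] in auto)
  then show ?thesis
    using err_r_1_eq_iff[OF _ N assms(3)] by (auto simp: opt_pairs1_def one_uniform_pair_def)
qed

section \<open>Dual pairs that are optimal for two erasures\<close>

text \<open>Summed over all \<open>i\<close> and \<open>j\<close> the products give the trace of \<open>K \<circ> K\<close>; the constant diagonal
  contributes \<open>N * (op_trace K / N)\<^sup>2\<close> of it.\<close>

lemma one_uniform_pair_sum_products: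
  fixes K :: "'a::euclidean_space \<Rightarrow> 'a" and q :: real
  assumes "one_uniform_pair K N F G" and "2 \<le> N"
    and "q = (op_trace (K \<circ> K) - (op_trace K)\<^sup>2 / N) / (N * (real N - 1))"
    and "D = {(i, j). i \<in> {1..N} \<and> j \<in> {1..N} \<and> i \<noteq> j}"
  shows "(\<Sum>(i, j)\<in>D. (F i \<bullet> G j) * (F j \<bullet> G i)) = card D * q"
proof -
  let ?p = "\<lambda>(i, j). (F i \<bullet> G j) * (F j \<bullet> G i)" and ?I = "{1..N}"
  let ?E = "(\<lambda>i. (i, i)) ` ?I"
  have inj: "inj_on (\<lambda>i. (i, i)) ?I" by (rule inj_onI) simp
  have D: "D = ?I \<times> ?I - ?E" using assms(4) by auto
  have "sum ?p (?I \<times> ?I) = op_trace (K \<circ> K)"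
    using assms(1) dual_pair_trace_square[of K G F ?I]
    by (simp add: one_uniform_pair_def K_dual_pair_def sum.cartesian_product)
  moreover have "sum ?p ?E = (\<Sum>i\<in>?I. (op_trace K / N) * (op_trace K / N))"
    using assms(1,2) by (subst sum.reindex[OF inj]) (simp add: one_uniform_pair_iff)
  moreover have "sum ?p D = sum ?p (?I \<times> ?I) - sum ?p ?E"
    unfolding D by (intro sum_diff) auto
  moreover have "card D = N * N - N"
    unfolding D using card_image[OF inj] by (subst card_Diff_subset) auto
  then have "real (card D) = N * (real N - 1)"
    using assms(2) by (simp add: of_nat_diff algebra_simps)
  ultimately show ?thesis
    using assms(2,3) by (simp add: power2_eq_square)
qed

theorem theorem3p11:
  fixes K :: "'a::euclidean_space \<Rightarrow> 'a" and n N :: nat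
  assumes "DIM('a) = n" and "n \<le> N" and "2 \<le> N"
    and "bounded_linear K" and "pos_semidef_op K"
  shows "opt_r2 K N \<ge> beta K N \<and>
    ((\<exists>F G. two_uniform_pair K N F G) \<longrightarrow>
       opt_r2 K N = beta K N \<and>
       (\<forall>F G. K_dual_pair K N F G \<longrightarrow>
          ((F, G) \<in> opt_pairs2 K N \<longleftrightarrow> two_uniform_pair K N F G)))"
proof -
  have lin: "linear K" and dim: "DIM('a) \<le> N" and N: "0 < N" "real N > 1"
    using assms by (auto simp: bounded_linear.linear)
  define c where "c = op_trace K / N"
  define q where "q = (op_trace (K \<circ> K) - (op_trace K)\<^sup>2 / N) / (N * (real N - 1))"
  define D where "D = {(i, j). i \<in> {1..N} \<and> j \<in> {1..N} \<and> i \<noteq> j}"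
  have tr: "0 \<le> op_trace K"
    using assms(5) by (auto simp: op_trace_def pos_semidef_op_def intro: sum_nonneg)
  have sq: "(op_trace K)\<^sup>2 \<le> DIM('a) * op_trace (K \<circ> K)"
    using op_trace_square_le[OF lin] assms(5) by (simp add: pos_semidef_op_def)
  have "0 \<le> DIM('a) * op_trace (K \<circ> K)"
    by (rule order_trans[OF zero_le_power2 sq])
  then have tr2: "0 \<le> op_trace (K \<circ> K)"
    by (simp add: zero_le_mult_iff)
  have "DIM('a) * op_trace (K \<circ> K) \<le> N * op_trace (K \<circ> K)"
    using dim tr2 by (intro mult_right_mono) auto
  then have "(op_trace K)\<^sup>2 \<le> N * op_trace (K \<circ> K)"
    by (rule order_trans[OF sq])
  \<comment> \<open>This rules out the second case of \<open>beta\<close> and makes the average \<open>q\<close> nonnegative.\<close>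
  then have le: "(op_trace K)\<^sup>2 / N \<le> op_trace (K \<circ> K)"
    using N by (simp add: field_simps)
  have c: "0 \<le> c" and q: "0 \<le> q"
    using tr le N by (auto simp: c_def q_def)
  have "q = (real N * op_trace (K \<circ> K) - (op_trace K)\<^sup>2) / ((real N)\<^sup>2 * (real N - 1))"
    using N by (simp add: q_def field_simps power2_eq_square)
  then have beta: "beta K N = c + sqrt q"
    using le by (simp add: beta_def c_def)
  have D: "finite D" "D \<noteq> {}"
  proof -
    show "finite D" by (rule finite_subset[of _ "{1..N} \<times> {1..N}"]) (auto simp: D_def)
    have "(1, 2) \<in> D" using assms(3) by (simp add: D_def)
    then show "D \<noteq> {}" by blast
  qed
  let ?L = "{\<Lambda>. \<Lambda> \<subseteq> {1..N} \<and> card \<Lambda> = 2}"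
  have L: "?L = (\<lambda>(i, j). {i, j}) ` D"
    by (auto simp: D_def card_2_iff image_iff)
  have err2: "err_r N 2 F G = Max ((\<lambda>(i, j). op_spectral_radius (error_op F G {i, j})) ` D)"
    for F G :: "nat \<Rightarrow> 'a"
    unfolding err_r_def L by (simp add: image_image case_prod_unfold)
  have one: "(F, G) \<in> opt_pairs1 K N \<longleftrightarrow> one_uniform_pair K N F G" for F G
    using opt_pairs1_iff_one_uniform[OF lin dim tr] .
  have rad: "op_spectral_radius (error_op F G {i, j}) = c + sqrt ((F i \<bullet> G j) * (F j \<bullet> G i))"
    if "one_uniform_pair K N F G" "(i, j) \<in> D" "0 \<le> (F i \<bullet> G j) * (F j \<bullet> G i)" for F G i j
    using that N c by (intro op_spectral_radius_error_op_pair)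
      (auto simp: D_def c_def one_uniform_pair_iff)
  have rad_le: "c + sqrt ((F i \<bullet> G j) * (F j \<bullet> G i)) \<le> err_r N 2 F G"
    if "one_uniform_pair K N F G" "(i, j) \<in> D" "0 \<le> (F i \<bullet> G j) * (F j \<bullet> G i)" for F G i j
    unfolding rad[OF that, symmetric] err2 using that D by (intro Max_ge) force+
  have sum: "(\<Sum>(i, j)\<in>D. (F i \<bullet> G j) * (F j \<bullet> G i)) = card D * q"
    if "one_uniform_pair K N F G" for F G
    using one_uniform_pair_sum_products[OF that assms(3) q_def D_def] .
  have lower: "beta K N \<le> err_r N 2 F G" if u: "one_uniform_pair K N F G" for F G
  proof -
    obtain i j where ij: "(i, j) \<in> D" "q \<le> (F i \<bullet> G j) * (F j \<bullet> G i)"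
      using exists_ge_average[OF D sum[OF u]] by auto
    then have "c + sqrt q \<le> c + sqrt ((F i \<bullet> G j) * (F j \<bullet> G i))" by simp
    then show ?thesis
      using rad_le[OF u ij(1)] ij(2) q beta by linarith
  qed
  have attained: "err_r N 2 F G = beta K N \<longleftrightarrow> two_uniform_pair K N F G"
    if u: "one_uniform_pair K N F G" for F G
  proof
    assume eq: "err_r N 2 F G = beta K N"
    have le: "(case x of (i, j) \<Rightarrow> (F i \<bullet> G j) * (F j \<bullet> G i)) \<le> q" if x: "x \<in> D" for x
    proof (rule ccontr)
      obtain i j where ij: "x = (i, j)" by (cases x)
      assume "\<not> ?thesis"
      then have less: "q < (F i \<bullet> G j) * (F j \<bullet> G i)" by (simp add: ij)
      then have "c + sqrt q < c + sqrt ((F i \<bullet> G j) * (F j \<bullet> G i))" by simp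
      moreover have "c + sqrt ((F i \<bullet> G j) * (F j \<bullet> G i)) \<le> err_r N 2 F G"
        using rad_le[OF u] x ij less q by auto
      ultimately show False using eq beta by linarith
    qed
    have "(F i \<bullet> G j) * (F j \<bullet> G i) = q" if "(i, j) \<in> D" for i j
      using sum_le_const_imp_eq[OF D(1) le sum[OF u] that] by simp
    then show "two_uniform_pair K N F G"
      using u by (auto simp: two_uniform_pair_def D_def)
  next
    assume "two_uniform_pair K N F G"
    then obtain c' where c': "\<And>i j. (i, j) \<in> D \<Longrightarrow> (F i \<bullet> G j) * (F j \<bullet> G i) = c'"
      by (auto simp: two_uniform_pair_def D_def)
    have "(\<Sum>(i, j)\<in>D. (F i \<bullet> G j) * (F j \<bullet> G i)) = (\<Sum>x\<in>D. c')"
      by (rule sum.cong) (auto simp: c')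
    then have "c' = q" using sum[OF u] D by simp
    then have "op_spectral_radius (error_op F G {i, j}) = beta K N" if "(i, j) \<in> D" for i j
      using rad[OF u that] c'[OF that] q beta by simp
    then have "(\<lambda>(i, j). op_spectral_radius (error_op F G {i, j})) ` D = (\<lambda>x. beta K N) ` D"
      by (intro image_cong) auto
    also have "\<dots> = {beta K N}" using D(2) by (simp add: image_constant_conv)
    finally show "err_r N 2 F G = beta K N"
      by (simp add: err2)
  qed
  obtain F0 G0 where "one_uniform_pair K N F0 G0"
    using exists_one_uniform_pair[OF lin dim] by blast
  then have ge: "beta K N \<le> opt_r2 K N"
    unfolding opt_r2_def using lower by (intro cInf_greatest) (auto simp: one)
  have eq: "opt_r2 K N = beta K N" if "two_uniform_pair K N F G" for F G
    unfolding opt_r2_def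
  proof (rule cInf_eq_minimum)
    have u: "one_uniform_pair K N F G" using that by (simp add: two_uniform_pair_def)
    then have "beta K N = err_r N 2 F G" and "(F, G) \<in> opt_pairs1 K N"
      using attained[OF u] that by (simp_all add: one)
    then show "beta K N \<in> {err_r N 2 F G |F G. (F, G) \<in> opt_pairs1 K N}"
      by blast
  qed (use lower one in auto)
  have "(F, G) \<in> opt_pairs2 K N \<longleftrightarrow> two_uniform_pair K N F G"
    if "opt_r2 K N = beta K N" for F G
    using attained[of F G] that by (auto simp: opt_pairs2_def one two_uniform_pair_def)
  with ge eq show ?thesis by blast
qed

end
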